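(* Let $\mathbb{K}$ be a field, let $\lambda\in\mathbb{K}^\times$, and let $E_\lambda$ be the evolution algebra over $\mathbb{K}$ with natural basis $\{e_1,e_2,e_3\}$ and multiplication determined by $e_ie_j=0$ for $i\neq j$ and $$e_1^2=-e_1-e_3,\qquad e_2^2=-2e_1+\lambda e_2+(\lambda-2)e_3,\qquad e_3^2=e_1+e_3.$$ Then $E_\lambda$ is not solvable. If $\lambda\neq 2$ in $\mathbb{K}$, then $E_\lambda$ has exactly one non-zero idempotent, namely $$\frac{1}{\lambda(2-\lambda)}(e_1+e_3)+\frac{1}{\lambda}(e_2+e_3).$$ If $\lambda=2$ in $\mathbb{K}$, then $0$ is the only idempotent of $E_\lambda$.
   Context: An evolution algebra over a field $\mathbb{K}$ is a commutative, not necessarily associative, $\mathbb{K}$-algebra $E$ admitting a basis $\{e_1,\dots,e_n\}$ (called a natural basis) with $e_ie_j=0$ for all $i\ne j$. For subspaces $U,V$ of an algebra, $UV$ denotes the linear span of the products $uv$ with $u\in U$, $v\in V$. The derived series of an algebra $A$ is $A^{(1)}=A$, $A^{(m+1)}=A^{(m)}A^{(m)}$ for $m\ge1$; $A$ is solvable if $A^{(m)}=0$ for some $m$. An idempotent is an element $x$ with $x^2=x$ (so $0$ is an idempotent). *)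

theory Defs
  imports "HOL-Analysis.Cartesian_Space"
begin

locale comm_algebra = vector_space smul
  for smul :: "'k::field \<Rightarrow> 'v::ab_group_add \<Rightarrow> 'v" +
  fixes mult :: "'v \<Rightarrow> 'v \<Rightarrow> 'v"
  assumes mult_commute: "mult x y = mult y x"
    and mult_add_left: "mult (x + y) z = mult x z + mult y z"
    and mult_scale_left: "mult (smul a x) y = smul a (mult x y)"
begin

text \<open>An algebra is an evolution algebra precisely when it has a natural basis.\<close>

definition natural_basis :: "'v set \<Rightarrow> bool" where
  "natural_basis B \<longleftrightarrow> finite B \<and> independent B \<and> span B = UNIV \<and>
     (\<forall>x\<in>B. \<forall>y\<in>B. x \<noteq> y \<longrightarrow> mult x y = 0)"

definition subspace_mult :: "'v set \<Rightarrow> 'v set \<Rightarrow> 'v set" where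
  "subspace_mult U V = span {mult u v | u v. u \<in> U \<and> v \<in> V}"

text \<open>The series is indexed from 1; the value at 0 is a dummy.\<close>

fun derived_series :: "nat \<Rightarrow> 'v set" where
  "derived_series 0 = UNIV"
| "derived_series (Suc 0) = UNIV"
| "derived_series (Suc (Suc m)) =
     subspace_mult (derived_series (Suc m)) (derived_series (Suc m))"

definition solvable :: bool where
  "solvable \<longleftrightarrow> (\<exists>m\<ge>1. derived_series m = {0})"

definition idempotent :: "'v \<Rightarrow> bool" where
  "idempotent x \<longleftrightarrow> mult x x = x"

end

text \<open>A basis with prescribed squares determines an evolution algebra up to isomorphism, so
  \<open>E\<^sub>\<lambda>\<close> is treated as any algebra with a natural basis satisfying this predicate. The
  lemma below exhibits such an algebra on coordinate space.\<close>

definition is_E_lambda ::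
  "('k::field \<Rightarrow> 'v::ab_group_add \<Rightarrow> 'v) \<Rightarrow> ('v \<Rightarrow> 'v \<Rightarrow> 'v) \<Rightarrow> 'k \<Rightarrow> 'v \<Rightarrow> 'v \<Rightarrow> 'v \<Rightarrow> bool" where
  "is_E_lambda smul mult lam e1 e2 e3 \<longleftrightarrow>
     comm_algebra smul mult \<and>
     distinct [e1, e2, e3] \<and> comm_algebra.natural_basis smul mult {e1, e2, e3} \<and>
     mult e1 e1 = - e1 - e3 \<and>
     mult e2 e2 = smul (- 2) e1 + smul lam e2 + smul (lam - 2) e3 \<and>
     mult e3 e3 = e1 + e3"

lemma is_E_lambda_exists:
  fixes lam :: "'k::field"
  shows "\<exists>mult (e1 :: 'k ^ 3) e2 e3. is_E_lambda (*s) mult lam e1 e2 e3"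
proof -
  define mult :: "'k ^ 3 \<Rightarrow> 'k ^ 3 \<Rightarrow> 'k ^ 3" where
    "mult = (\<lambda>x y. vector [- (x$1 * y$1) - 2 * (x$2 * y$2) + x$3 * y$3,
                           lam * (x$2 * y$2),
                           - (x$1 * y$1) + (lam - 2) * (x$2 * y$2) + x$3 * y$3])"
  let ?e = "\<lambda>i. axis i (1::'k) :: 'k ^ 3"
  interpret comm_algebra "(*s)" mult
    by unfold_locales (simp_all add: mult_def vec_eq_iff forall_3 vector_3 algebra_simps)
  have ax: "?e i $ j = (if i = j then 1 else 0)" for i j
    by (simp add: axis_def)
  have basis: "{?e 1, ?e 2, ?e 3} = cart_basis"
    by (auto simp: cart_basis_def) (metis exhaust_3)
  have "natural_basis {?e 1, ?e 2, ?e 3}"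
    unfolding natural_basis_def
  proof (intro conjI)
    show "vec.independent {?e 1, ?e 2, ?e 3}" "vec.span {?e 1, ?e 2, ?e 3} = UNIV"
      unfolding basis by (simp_all add: independent_cart_basis span_cart_basis)
    show "\<forall>x\<in>{?e 1, ?e 2, ?e 3}. \<forall>y\<in>{?e 1, ?e 2, ?e 3}. x \<noteq> y \<longrightarrow> mult x y = 0"
      by (auto simp: mult_def vec_eq_iff forall_3 vector_3 ax)
  qed simp
  then have "is_E_lambda (*s) mult lam (?e 1) (?e 2) (?e 3)"
    unfolding is_E_lambda_def using comm_algebra_axioms
    by (simp add: axis_eq_axis) (simp add: mult_def vec_eq_iff forall_3 vector_3 ax)
  then show ?thesis by blast
qed

end

theory Submission
  imports Defs
begin

text \<open>With \<open>f = e\<^sub>1 + e\<^sub>3\<close> and \<open>g = e\<^sub>2 + e\<^sub>3\<close> one has \<open>f g = f\<close> and \<open>g\<^sup>2 = \<lambda> g - f\<close>. As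
  \<open>\<lambda> \<noteq> 0\<close>, both \<open>f\<close> and \<open>g\<close> lie in \<open>U U\<close> whenever they lie in \<open>U\<close>, so every term of the derived
  series contains \<open>f \<noteq> 0\<close>. All squares lie in the span of \<open>f\<close> and \<open>g\<close>, because those
  of the \<open>e\<^sub>i\<close> do; and since \<open>f\<^sup>2 = 0\<close>, the element \<open>a f + b g\<close> is idempotent iff \<open>b = \<lambda> b\<^sup>2\<close> and
  \<open>a = 2 a b - b\<^sup>2\<close>. For \<open>b = 1 / \<lambda>\<close> the latter reads \<open>\<lambda> (2 - \<lambda>) a = 1\<close>.\<close>

context comm_algebra
begin

lemma mult_add_right: "mult x (y + z) = mult x y + mult x z"
  by (metis mult_add_left mult_commute)

lemma mult_scale_right: "mult x (smul a y) = smul a (mult x y)"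
  by (metis mult_scale_left mult_commute)

lemma mult_zero_left: "mult 0 x = 0"
  using mult_scale_left[of 0 0 x] by simp

lemma subspace_derived_series: "subspace (derived_series m)"
  by (induction m rule: derived_series.induct) (simp_all add: subspace_mult_def)

end

locale E_lambda = comm_algebra smul mult
  for smul :: "'k::field \<Rightarrow> 'v::ab_group_add \<Rightarrow> 'v" and mult +
  fixes lam :: 'k and e1 e2 e3 :: 'v
  assumes distinct: "distinct [e1, e2, e3]"
    and basis: "natural_basis {e1, e2, e3}"
    and e1_square: "mult e1 e1 = - e1 - e3"
    and e2_square: "mult e2 e2 = smul (- 2) e1 + smul lam e2 + smul (lam - 2) e3"
    and e3_square: "mult e3 e3 = e1 + e3"
begin

definition f where "f = e1 + e3"
definition g where "g = e2 + e3"

lemma mult_basis [simp]: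
  "mult e1 e2 = 0" "mult e2 e1 = 0" "mult e1 e3 = 0"
  "mult e3 e1 = 0" "mult e2 e3 = 0" "mult e3 e2 = 0"
  using basis distinct by (auto simp: natural_basis_def)

text \<open>The coefficient \<open>lam - 2\<close> of \<open>e3\<close> splits into
  \<open>lam\<close> from \<open>g\<close> and \<open>- 2\<close> from \<open>f\<close>.\<close>

lemma e2_square_eq: "mult e2 e2 = smul lam g - smul 2 f"
  by (simp add: e2_square f_def g_def scale_right_distrib scale_left_diff_distrib)

lemma mult_f_f: "mult f f = 0"
  by (simp add: f_def mult_add_left mult_add_right e1_square e3_square)

lemma mult_f_g: "mult f g = f"
  by (simp add: f_def g_def mult_add_left mult_add_right e3_square)

lemma mult_g_g: "mult g g = smul lam g - f"
proof -
  have "mult g g = smul lam g - smul 2 f + f"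
    by (simp add: g_def mult_add_left mult_add_right e3_square f_def[symmetric]
        e2_square_eq[unfolded g_def])
  moreover have "smul 2 f = f + f"
    by (metis one_add_one scale_left_distrib scale_one)
  ultimately show ?thesis by simp
qed

text \<open>The \<open>a\<^sup>2\<close> term vanishes with \<open>mult f f\<close>, the two cross
  terms give \<open>2 * a * b\<close>, and \<open>mult g g\<close> contributes to both
  coefficients.\<close>

lemma square_f_g:
  "mult (smul a f + smul b g) (smul a f + smul b g)
    = smul (2 * a * b - b\<^sup>2) f + smul (lam * b\<^sup>2) g"
proof -
  have "mult (smul a f + smul b g) (smul a f + smul b g)
      = smul (a * b) f + smul (a * b) f + smul (b * b) (smul lam g - f)"
    by (simp add: mult_add_left mult_add_right mult_scale_left mult_scale_right
        mult_f_f mult_f_g mult_g_g mult_commute[of g f] scale_right_distrib mult.commute[of b a])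
  also have "\<dots> = smul (a * b + a * b - b * b) f + smul (b * b * lam) g"
    by (simp only: scale_left_distrib scale_left_diff_distrib scale_right_diff_distrib scale_scale)
       (simp add: algebra_simps)
  also have "a * b + a * b - b * b = 2 * a * b - b\<^sup>2"
    by (simp add: power2_eq_square algebra_simps)
  finally show ?thesis by (simp add: power2_eq_square mult_ac)
qed

lemma coordinates:
  obtains a b c where "x = smul a e1 + smul b e2 + smul c e3"
proof -
  have "x \<in> span {e1, e2, e3}"
    using basis by (simp add: natural_basis_def)
  \<comment> \<open>\<open>span_insert\<close> peels off one basis vector at a time; the remainder
    lies in the span of the empty set, hence is 0.\<close>
  then obtain a b c where "x - smul a e1 - smul b e2 - smul c e3 = 0"
    unfolding span_insert by auto
  then have "x = smul a e1 + smul b e2 + smul c e3"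
    by (simp add: algebra_simps)
  then show thesis by (rule that)
qed

lemma coordinates_eq_0:
  assumes "smul a e1 + smul b e2 + smul c e3 = 0"
  shows "a = 0" "b = 0" "c = 0"
proof -
  \<comment> \<open>The three coefficients become one function on the basis, as the set-based form
    of independence requires; distinctness makes it take the intended values.\<close>
  define u where "u x = (if x = e1 then a else if x = e2 then b else c)" for x
  have "(\<Sum>x\<in>{e1, e2, e3}. smul (u x) x) = 0"
    using assms distinct by (auto simp: u_def add.assoc)
  then have "\<forall>x\<in>{e1, e2, e3}. u x = 0"
    using basis by (auto simp: natural_basis_def independent_explicit_finite_subsets)
  then show "a = 0" "b = 0" "c = 0"
    using distinct by (auto simp: u_def)
qed

lemma f_g_eq_0:
  assumes "smul a f + smul b g = 0"
  shows "a = 0" "b = 0"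
  \<comment> \<open>Both \<open>f\<close> and \<open>g\<close> contain \<open>e3\<close>, so its
    coordinate is \<open>a + b\<close>.\<close>
  using assms coordinates_eq_0[of a b "a + b"]
  by (simp_all add: f_def g_def scale_right_distrib scale_left_distrib ac_simps)

lemma f_nonzero: "f \<noteq> 0"
  using f_g_eq_0(1)[of 1 0] by auto

text \<open>An idempotent is its own square, so this confines all idempotents to the plane of
  \<open>f\<close> and \<open>g\<close>.\<close>

lemma square_in_span:
  obtains a b where "mult x x = smul a f + smul b g"
proof -
  obtain p q r where x: "x = smul p e1 + smul q e2 + smul r e3"
    by (rule coordinates)
  have e1: "mult e1 e1 = - f"
    by (simp add: e1_square f_def)
  have e3: "mult e3 e3 = f"
    by (simp add: e3_square f_def)
  have "mult x x = smul (p * p) (- f) + smul (q * q) (smul lam g - smul 2 f) + smul (r * r) f"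
    unfolding x
    by (simp add: mult_add_left mult_add_right mult_scale_left mult_scale_right
        e1 e2_square_eq e3)
  also have "\<dots> = smul (r * r - p * p - q * q * 2) f + smul (q * q * lam) g"
    by (simp only: scale_left_diff_distrib scale_right_diff_distrib scale_scale
        scale_minus_right) (simp add: algebra_simps)
  finally show thesis by (rule that)
qed

lemma idempotent_f_g_iff:
  "idempotent (smul a f + smul b g) \<longleftrightarrow> b = lam * b\<^sup>2 \<and> a = 2 * a * b - b\<^sup>2"
proof
  assume "idempotent (smul a f + smul b g)"
  then have "smul (2 * a * b - b\<^sup>2 - a) f + smul (lam * b\<^sup>2 - b) g = 0"
    unfolding idempotent_def square_f_g
    by (simp only: scale_left_diff_distrib) (simp add: algebra_simps)
  from f_g_eq_0[OF this] show "b = lam * b\<^sup>2 \<and> a = 2 * a * b - b\<^sup>2"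
    by simp
qed (simp add: idempotent_def square_f_g)

lemma idempotent_iff:
  assumes "lam \<noteq> 0"
  shows "idempotent x \<longleftrightarrow> x = 0 \<or>
    lam \<noteq> 2 \<and> x = smul (1 / (lam * (2 - lam))) f + smul (1 / lam) g"
proof
  assume x: "idempotent x"
  then obtain a b where ab: "x = smul a f + smul b g"
    using square_in_span[of x] unfolding idempotent_def by metis
  have b: "b = lam * b\<^sup>2" and a: "a = 2 * a * b - b\<^sup>2"
    using x unfolding ab idempotent_f_g_iff by auto
  show "x = 0 \<or> lam \<noteq> 2 \<and> x = smul (1 / (lam * (2 - lam))) f + smul (1 / lam) g"
  proof (cases "b = 0")
    case True
    then show ?thesis using a ab by simp
  next
    case False
    then have "lam * b = 1"
      using b by (simp add: power2_eq_square)
    then have b': "b = 1 / lam"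
      using assms by (simp add: field_simps)
    \<comment> \<open>After scaling by \<open>lam\<^sup>2\<close>, the relation
      \<open>lam * b = 1\<close> eliminates \<open>b\<close> and leaves a linear equation for
      \<open>a\<close>.\<close>
    have "lam\<^sup>2 * a = lam\<^sup>2 * (2 * a * b - b\<^sup>2)"
      by (rule arg_cong[OF a])
    also have "\<dots> = 2 * a * lam * (lam * b) - (lam * b)\<^sup>2"
      by (simp add: power2_eq_square algebra_simps)
    finally have "lam\<^sup>2 * a = 2 * a * lam - 1"
      by (simp add: \<open>lam * b = 1\<close>)
    then have *: "a * (lam * (2 - lam)) = 1"
      by (simp add: power2_eq_square algebra_simps)
    \<comment> \<open>For \<open>lam = 2\<close> the equation \<open>*\<close> would read 0 =
      1.\<close>
    then have "lam \<noteq> 2" by auto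
    with * have "a = 1 / (lam * (2 - lam))"
      using assms by (simp add: eq_divide_eq)
    with b' \<open>lam \<noteq> 2\<close> ab show ?thesis by simp
  qed
next
  assume "x = 0 \<or> lam \<noteq> 2 \<and> x = smul (1 / (lam * (2 - lam))) f + smul (1 / lam) g"
  then show "idempotent x"
  proof (elim disjE conjE)
    assume "x = 0"
    then show ?thesis by (simp add: idempotent_def mult_zero_left)
  next
    assume "lam \<noteq> 2" and x: "x = smul (1 / (lam * (2 - lam))) f + smul (1 / lam) g"
    then have "2 - lam \<noteq> 0" by simp
    then show ?thesis
      unfolding x idempotent_f_g_iff using assms
      by (simp add: divide_simps power2_eq_square)
  qed
qed

lemma f_g_in_derived_series:
  assumes "lam \<noteq> 0"
  shows "f \<in> derived_series m \<and> g \<in> derived_series m"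
proof (induction m rule: derived_series.induct)
  case (3 m)
  let ?D = "derived_series (Suc (Suc m))"
  have prod: "mult u v \<in> ?D" if "u \<in> {f, g}" "v \<in> {f, g}" for u v
    using that 3 by (auto simp: subspace_mult_def intro!: span_base)
  have f: "f \<in> ?D"
    using prod[of f g] by (simp add: mult_f_g)
  \<comment> \<open>This vector is \<open>g\<close>, recovered by solving the formula for
    \<open>mult g g\<close>.\<close>
  have "smul (1 / lam) (mult g g + f) \<in> ?D"
    using prod[of g g] f by (intro subspace_scale subspace_add subspace_derived_series) auto
  then have "g \<in> ?D"
    using assms by (simp add: mult_g_g)
  with f show ?case by blast
qed auto

lemma not_solvable:
  assumes "lam \<noteq> 0"
  shows "\<not> solvable"
  using f_g_in_derived_series[OF assms] f_nonzero unfolding solvable_def by blast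

end

theorem theorem2p1:
  fixes smul :: "'k::field \<Rightarrow> 'v::ab_group_add \<Rightarrow> 'v"
    and mult :: "'v \<Rightarrow> 'v \<Rightarrow> 'v"
    and lam :: 'k
    and e1 e2 e3 :: 'v
  assumes "lam \<noteq> 0"
    and "is_E_lambda smul mult lam e1 e2 e3"
  shows "\<not> comm_algebra.solvable smul mult \<and>
    (lam \<noteq> 2 \<longrightarrow>
      {x. x \<noteq> 0 \<and> comm_algebra.idempotent mult x} =
      {smul (1 / (lam * (2 - lam))) (e1 + e3) + smul (1 / lam) (e2 + e3)}) \<and>
    (lam = 2 \<longrightarrow> {x. comm_algebra.idempotent mult x} = {0})"
proof -
  interpret E_lambda smul mult lam e1 e2 e3
    using assms(2) unfolding is_E_lambda_def E_lambda_def E_lambda_axioms_def by blast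
  \<comment> \<open>The coefficient of \<open>g\<close> is non-zero. This covers
    \<open>lam = 2\<close> too, where division by zero makes the coefficient of \<open>f\<close>
    equal to 0.\<close>
  have "smul (1 / (lam * (2 - lam))) f + smul (1 / lam) g \<noteq> 0"
    using f_g_eq_0(2) assms(1) by fastforce
  then show ?thesis
    using not_solvable[OF assms(1)] idempotent_iff[OF assms(1)]
    by (auto simp: f_def g_def)
qed

end
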